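(* Let $\{A_k\}$ be a finite or countable family of Borel subsets of $\mathbb{R}^d$ such that $$A_n \cap \overline{\bigcup_{k\neq n} A_k}$$ is countable for all $n$. Then $$\dim_{\mathrm{F}}\Big(\bigcup_k A_k\Big) = \sup_k \dim_{\mathrm{F}} A_k.$$
   Context: For a finite Borel measure $\mu$ on $\mathbb{R}^d$, $\widehat\mu(\xi)=\int e^{-2\pi i \xi\cdot x}\,d\mu(x)$ for $\xi\in\mathbb{R}^d$. The notation $f(\xi)\lesssim g(\xi)$ means there is a constant $C$ with $|f(\xi)|\le C|g(\xi)|$ for all $\xi$ (negative powers of $|\xi|$ are read as $+\infty$ at $\xi=0$). The Fourier dimension of $\mu$ is $\dim_{\mathrm{F}}\mu=\sup\{s\in[0,d]:\ \widehat\mu(\xi)\lesssim|\xi|^{-s/2}\}$. For a Borel set $A\subset\mathbb{R}^d$, $\mathcal{P}(A)$ is the set of Borel probability measures $\mu$ on $\mathbb{R}^d$ with $\mu(A)=1$, and the Fourier dimension of $A$ is $\dim_{\mathrm{F}}A=\sup\{\dim_{\mathrm{F}}\mu:\ \mu\in\mathcal{P}(A)\}$. Suprema of empty sets of dimensions are $0$. The bar denotes topological closure in $\mathbb{R}^d$. *)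

theory Defs
  imports "HOL-Probability.Probability"
begin

definition fourier_transform :: "'a::euclidean_space measure \<Rightarrow> 'a \<Rightarrow> complex" where
  "fourier_transform \<mu> \<xi> =
     (LINT x|\<mu>. exp (- 2 * complex_of_real pi * \<i> * complex_of_real (\<xi> \<bullet> x)))"

(* Sup of the empty set of reals is unspecified in the library; the convention here is 0.
   All other sets of dimensions are bounded subsets of [0,d]. *)
definition dim_Sup :: "real set \<Rightarrow> real" where
  "dim_Sup D = (if D = {} then 0 else Sup D)"

(* The point 0 is left out because negative powers of 0 are read as infinity
   (whereas 0 powr a = 0 in the library). For s = 0 nothing is lost: the transform
   of a finite measure is bounded, in particular finite at 0. *)
definition fourier_decay :: "'a::euclidean_space measure \<Rightarrow> real \<Rightarrow> bool" where
  "fourier_decay \<mu> s \<longleftrightarrow>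
     (\<exists>C. \<forall>\<xi>. \<xi> \<noteq> 0 \<longrightarrow> norm (fourier_transform \<mu> \<xi>) \<le> C * norm \<xi> powr (- s / 2))"

definition fourier_dim_measure :: "'a::euclidean_space measure \<Rightarrow> real" where
  "fourier_dim_measure \<mu> = dim_Sup {s \<in> {0..real DIM('a)}. fourier_decay \<mu> s}"

definition borel_prob_on :: "'a::euclidean_space set \<Rightarrow> 'a measure set" where
  "borel_prob_on A = {\<mu>. sets \<mu> = sets borel \<and> prob_space \<mu> \<and> measure \<mu> A = 1}"

definition fourier_dim :: "'a::euclidean_space set \<Rightarrow> real" where
  "fourier_dim A = dim_Sup (fourier_dim_measure ` borel_prob_on A)"

end

theory Submission
  imports Defs
begin

text \<open>
  Decay of the transform of \<open>\<mu>\<close> survives multiplication by a smooth compactly supported weight.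
  Decay of positive order also rules out atoms, so countable sets are null. Hence if \<open>\<mu>\<close> lives on
  the union and decays, some \<open>A n\<close> has positive mass off the closed set \<open>closure (\<Union>k\<in>I - {n}. A k)\<close>,
  and a cutoff supported in the complement of that set turns \<open>\<mu>\<close> into a measure on \<open>A n\<close>
  with the same decay.

  The weights are products over the coordinate directions of functions \<open>h (x \<bullet> b - c)\<close> with
  \<open>h y = \<rho> {y - a<..y + a}\<close>, where \<open>\<rho>\<close> is an iterated convolution of a uniform distribution.
  Levy's inversion formula writes \<open>h\<close> as a superposition of characters with an amplitude decaying
  faster than any prescribed power, so multiplying by \<open>h (x \<bullet> b - c)\<close> only averages translates
  of the transform.
\<close>

section \<open>Characteristic functions: uniform laws, convolution powers, inversion\<close>

text \<open>Integrating the character exactly over the interval leaves two boundary terms of modulus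
  \<open>1 / \<bar>t\<bar>\<close>, and the density \<open>1 / (2 * r)\<close> absorbs their number.
  This single power of decay is what convolution multiplies.\<close>

lemma norm_char_uniform_le:
  fixes r t :: real
  assumes r: "r > 0" and t: "t \<noteq> 0"
  shows "norm (char (uniform_measure lborel {-r..r}) t) \<le> 1 / (r * \<bar>t\<bar>)"
proof -
  have U: "uniform_measure lborel {-r..r} = density lborel (\<lambda>x. ennreal (indicator {-r..r} x / (2 * r)))"
    unfolding uniform_measure_def using r
    by (intro density_cong) (auto split: split_indicator simp: divide_ennreal ennreal_1[symmetric] simp del: ennreal_1)
  have "has_bochner_integral lborel (\<lambda>x. indicator {-r..r} x *\<^sub>R iexp (t * x))
    (iexp (t * r) / (\<i> * t) - iexp (t * - r) / (\<i> * t))"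
  proof (rule has_bochner_integral_FTC_Icc)
    show "((\<lambda>x. iexp (t * x) / (\<i> * t)) has_vector_derivative iexp (t * x)) (at x within {-r..r})" for x
      using t by (auto intro!: derivative_eq_intros simp: has_vector_derivative_complex_iff Re_exp Im_exp
        Re_divide Im_divide power2_eq_square field_simps)
  qed (use r in \<open>auto intro!: continuous_intros\<close>)
  then have I: "(LINT x|lborel. indicator {-r..r} x *\<^sub>R iexp (t * x)) =
    iexp (t * r) / (\<i> * t) - iexp (t * - r) / (\<i> * t)"
    by (rule has_bochner_integral_integral_eq)
  have "char (uniform_measure lborel {-r..r}) t = (LINT x|lborel. (indicator {-r..r} x / (2 * r)) *\<^sub>R iexp (t * x))"
    unfolding char_def U using r by (subst integral_density) auto
  also have "\<dots> = (LINT x|lborel. (1 / (2 * r)) *\<^sub>R (indicator {-r..r} x *\<^sub>R iexp (t * x)))"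
    by (intro Bochner_Integration.integral_cong) auto
  also have "\<dots> = (1 / (2 * r)) *\<^sub>R (iexp (t * r) / (\<i> * t) - iexp (t * - r) / (\<i> * t))"
    by (simp only: integral_scaleR_right I)
  also have "norm \<dots> = norm (iexp (t * r) / (\<i> * t) - iexp (t * - r) / (\<i> * t)) / (2 * r)"
    using r by simp
  also have "\<dots> \<le> (norm (iexp (t * r) / (\<i> * t)) + norm (iexp (t * - r) / (\<i> * t))) / (2 * r)"
    using r by (intro divide_right_mono norm_triangle_ineq4) auto
  also have "\<dots> = 1 / (r * \<bar>t\<bar>)"
    by (simp only: norm_divide norm_mult norm_exp_i_times norm_of_real norm_ii) (use r t in \<open>simp add: field_simps\<close>)
  finally show ?thesis .
qed

text \<open>\<open>M\<close> is the law of a sum of \<open>n\<close> independent copies of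
  \<open>U\<close>, built by adding one copy at a time on a product space. Supports add while
  characteristic functions multiply, so any polynomial order of decay is available with compact
  support.\<close>

lemma real_distribution_iterated_convolution:
  assumes "real_distribution U" and U: "AE x in U. \<bar>x\<bar> \<le> r"
  shows "\<exists>M. real_distribution M \<and> (AE x in M. \<bar>x\<bar> \<le> real n * r) \<and> (\<forall>t. char M t = char U t ^ n)"
proof (induction n)
  case 0
  have "real_distribution (return borel (0::real))"
    by (intro real_distribution.intro real_distribution_axioms.intro prob_space_return) auto
  then show ?case
    by (intro exI[of _ "return borel 0"]) (auto simp: char_def integral_return AE_return)
next
  case (Suc n)
  then obtain M where M: "real_distribution M" "AE x in M. \<bar>x\<bar> \<le> real n * r"
    and ch: "\<And>t. char M t = char U t ^ n" by blast
  interpret M: real_distribution M by fact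
  interpret U: real_distribution U by fact
  interpret P: pair_prob_space M U ..
  let ?D = "distr (M \<Otimes>\<^sub>M U) borel (\<lambda>z. fst z + snd z)"
  have D: "real_distribution ?D"
    by (intro real_distribution.intro real_distribution_axioms.intro P.prob_space_distr) auto
  have "AE z in M \<Otimes>\<^sub>M U. \<bar>fst z\<bar> \<le> real n * r"
    by (rule P.AE_pair_measure, measurable) (use M(2) in auto)
  moreover have "AE z in M \<Otimes>\<^sub>M U. \<bar>snd z\<bar> \<le> r"
    by (rule P.AE_pair_measure, measurable) (use U in auto)
  ultimately have "AE z in M \<Otimes>\<^sub>M U. \<bar>fst z + snd z\<bar> \<le> real (Suc n) * r"
    by eventually_elim (auto simp: algebra_simps)
  then have "AE x in ?D. \<bar>x\<bar> \<le> real (Suc n) * r"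
    by (subst AE_distr_iff) auto
  moreover have "char ?D t = char U t ^ Suc n" for t
  proof -
    have "char ?D t = (LINT z|(M \<Otimes>\<^sub>M U). iexp (t * (fst z + snd z)))"
      unfolding char_def by (subst integral_distr) auto
    also have "\<dots> = (LINT x|M. LINT y|U. iexp (t * (x + y)))"
      by (subst P.integral_fst'[symmetric])
         (auto intro!: P.integrable_const_bound[where B = 1])
    also have "\<dots> = (LINT x|M. LINT y|U. iexp (t * x) * iexp (t * y))"
      by (simp add: ring_distribs exp_add)
    also have "\<dots> = char M t * char U t"
      by (simp add: char_def)
    finally show ?thesis by (simp add: ch mult.commute)
  qed
  ultimately show ?case using D by blast
qed

lemma integrable_inverse_one_plus_square: "integrable lborel (\<lambda>x::real. inverse (1 + x\<^sup>2))"
  using integrable_inverse_1_plus_square unfolding set_integrable_def by simp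

text \<open>The trivial bound 1 handles the summand 1 and the decay bound handles
  \<open>\<bar>t\<bar>\<close>. With \<open>1 + \<bar>t\<bar>\<close> in place of
  \<open>\<bar>t\<bar>\<close> the estimate has no singularity at 0.\<close>

lemma bounded_norm_char_power:
  assumes U: "real_distribution U" and r: "r > 0"
    and le: "\<And>t. t \<noteq> 0 \<Longrightarrow> norm (char U t) \<le> 1 / (r * \<bar>t\<bar>)"
  shows "norm (char U t) ^ n * (1 + \<bar>t\<bar>) ^ n \<le> (1 + 1 / r) ^ n"
proof -
  interpret real_distribution U by fact
  have "norm (char U t) * (1 + \<bar>t\<bar>) = norm (char U t) + norm (char U t) * \<bar>t\<bar>"
    by (simp add: algebra_simps)
  also have "\<dots> \<le> 1 + 1 / r"
  proof (cases "t = 0")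
    case False
    then have "norm (char U t) * \<bar>t\<bar> \<le> 1 / (r * \<bar>t\<bar>) * \<bar>t\<bar>"
      by (intro mult_right_mono le) auto
    also have "\<dots> = 1 / r" using False by simp
    finally show ?thesis using cmod_char_le_1[of t] by simp
  qed (use r char_zero in simp)
  finally have "(norm (char U t) * (1 + \<bar>t\<bar>)) ^ n \<le> (1 + 1 / r) ^ n"
    by (intro power_mono) auto
  then show ?thesis by (simp add: power_mult_distrib)
qed

text \<open>For nonzero \<open>t\<close> the quotient is the integral of \<open>iexp (t * x)\<close>
  over an interval of length \<open>2 * a\<close>. At \<open>t = 0\<close> it is 0 by the convention
  for division.\<close>

lemma interval_cutoff_kernel_bound:
  fixes a t :: real
  assumes "a > 0"
  shows "norm ((iexp (t * a) - iexp (t * - a)) / (\<i> * t)) \<le> 2 * a"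
  using Levy_Inversion_aux2[of "-a" a t] assms by (cases "t = 0") auto

text \<open>Levy's formula expresses the mass only as a limit of truncated integrals, and asks for
  endpoints without mass. Integrability of \<open>char M\<close> and the bounded kernel make the
  full integrand integrable, so dominated convergence replaces the limit by one Lebesgue
  integral.\<close>

lemma (in real_distribution) measure_interval_eq_integral:
  fixes a :: real
  assumes atomless: "\<And>x. measure M {x} = 0" and a: "a > 0"
    and int: "integrable lborel (\<lambda>t. norm (char M t))"
  shows "complex_of_real (measure M {y - a<..y + a}) =
    (CLINT t|lborel. (iexp (t * a) - iexp (t * - a)) / (\<i> * t) * char M t / (2 * pi) * iexp (- (t * y)))"
proof -
  let ?g = "\<lambda>t::real. (iexp (t * a) - iexp (t * - a)) / (\<i> * t) * char M t * iexp (- (t * y))"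
  let ?J = "\<lambda>T. 1 / (2 * pi) * (CLBINT t=ereal (- T)..ereal T. (iexp (-(t * (y - a))) - iexp (-(t * (y + a)))) / (\<i> * t) * char M t)"
  have bd: "norm (?g t) \<le> 2 * a * norm (char M t)" for t
    using interval_cutoff_kernel_bound[OF a, of t]
    by (simp only: norm_mult norm_exp_i_times mult_1_right) (intro mult_right_mono, auto)
  have gint: "integrable lborel ?g"
    by (rule Bochner_Integration.integrable_bound[OF integrable_mult_right[OF int, of "2 * a"]])
       (use bd a in \<open>auto intro: order.trans\<close>)
  have "(\<lambda>n. LINT t|lborel. indicator {- real n<..<real n} t *\<^sub>R ?g t) \<longlonglongrightarrow> (LINT t|lborel. ?g t)"
  proof (rule integral_dominated_convergence[where w = "\<lambda>t. norm (?g t)"])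
    show "AE t in lborel. (\<lambda>n. indicator {- real n<..<real n} t *\<^sub>R ?g t) \<longlonglongrightarrow> ?g t"
    proof (intro AE_I2 tendsto_eventually)
      fix t :: real
      obtain N where N: "\<bar>t\<bar> < real N" using reals_Archimedean2 by blast
      have "indicator {- real n<..<real n} t *\<^sub>R ?g t = ?g t" if "n \<ge> N" for n
      proof -
        have "t \<in> {- real n<..<real n}" using N that by auto
        then show ?thesis by simp
      qed
      then show "\<forall>\<^sub>F n in sequentially. indicator {- real n<..<real n} t *\<^sub>R ?g t = ?g t"
        unfolding eventually_sequentially by blast
    qed
  qed (use gint in \<open>auto split: split_indicator\<close>)
  moreover have "?J (real n) = 1 / (2 * pi) * (LINT t|lborel. indicator {- real n<..<real n} t *\<^sub>R ?g t)" for n :: nat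
  proof -
    \<comment> \<open>The common phase \<open>iexp (- (t * y))\<close> is pulled out of both
      endpoint terms, so that \<open>y\<close> occurs only there.\<close>
    have e: "(iexp (-(t * (y - a))) - iexp (-(t * (y + a)))) / (\<i> * t) * char M t = ?g t" for t
      by (simp add: algebra_simps diff_divide_distrib add_divide_distrib flip: exp_add)
    show ?thesis unfolding e
      by (simp add: interval_lebesgue_integral_def set_lebesgue_integral_def)
  qed
  ultimately have "(\<lambda>n. ?J (real n)) \<longlonglongrightarrow> 1 / (2 * pi) * (LINT t|lborel. ?g t)"
    by (simp only:) (intro tendsto_intros)
  moreover have "(\<lambda>n. ?J (real n)) \<longlonglongrightarrow> complex_of_real (measure M {y - a<..y + a})"
    using Levy_Inversion[of "y - a" "y + a"] atomless a by simp
  ultimately have "complex_of_real (measure M {y - a<..y + a}) = 1 / (2 * pi) * (LINT t|lborel. ?g t)"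
    using LIMSEQ_unique by blast
  also have "\<dots> = (LINT t|lborel. 1 / (2 * pi) * ?g t)" by (rule integral_mult_right_zero[symmetric])
  finally show ?thesis by (simp add: mult_ac)
qed

section \<open>Absence of atoms\<close>

text \<open>For integral \<open>\<theta>\<close> every summand is 1. Otherwise the sum is geometric
  with ratio \<open>w \<noteq> 1\<close> of modulus 1, hence bounded by
  \<open>2 / norm (w - 1)\<close> uniformly in \<open>N\<close>, and division by \<open>N\<close>
  kills it.\<close>

lemma geometric_mean_iexp_tendsto:
  fixes \<theta> :: real
  shows "(\<lambda>N. (\<Sum>n<N. exp (- 2 * of_real pi * \<i> * of_real (real n * \<theta>))) / of_nat N)
    \<longlonglongrightarrow> indicator \<int> \<theta>"
proof (cases "\<theta> \<in> \<int>")
  case True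
  have "exp (- 2 * of_real pi * \<i> * of_real (real n * \<theta>)) = 1" for n
  proof -
    from True obtain k where k: "\<theta> = of_int k" by (auto elim: Ints_cases)
    show ?thesis unfolding exp_eq_1
      by (auto simp: k intro!: exI[of _ "- int n * k"])
  qed
  then have "(\<Sum>n<N. exp (- 2 * of_real pi * \<i> * of_real (real n * \<theta>))) / of_nat N = (1::complex)" if "N > 0" for N
    using that by simp
  then show ?thesis using True
    by (intro tendsto_eventually) (auto simp: eventually_at_top_linorder intro!: exI[of _ 1])
next
  case False
  define w where "w = exp (- 2 * of_real pi * \<i> * of_real \<theta>)"
  have w1: "w \<noteq> 1"
  proof
    assume "w = 1"
    then obtain k where "- (2 * pi * \<theta>) = of_int (2 * k) * pi" unfolding w_def exp_eq_1 by auto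
    then have "pi * (\<theta> + of_int k) = 0" by (simp add: algebra_simps)
    then have "\<theta> = of_int (- k)" by simp
    with False show False by auto
  qed
  have nw: "norm w = 1" by (simp add: w_def norm_exp)
  have p: "exp (- 2 * of_real pi * \<i> * of_real (real n * \<theta>)) = w ^ n" for n
    unfolding w_def exp_of_nat_mult[symmetric] by (simp add: mult_ac)
  have bd: "norm ((\<Sum>n<N. exp (- 2 * of_real pi * \<i> * of_real (real n * \<theta>))) / of_nat N) \<le>
    2 / norm (w - 1) * inverse (real N)" for N
  proof -
    have "norm (w ^ N - 1) \<le> 2"
      using norm_triangle_ineq4[of "w ^ N" 1] by (simp add: norm_power nw)
    then have "norm (\<Sum>n<N. w ^ n) \<le> 2 / norm (w - 1)"
      using w1 by (simp add: geometric_sum norm_divide divide_right_mono)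
    then show ?thesis unfolding p
      by (simp add: norm_mult norm_inverse divide_inverse mult_right_mono)
  qed
  have "(\<lambda>N. 2 / norm (w - 1) * inverse (real N)) \<longlonglongrightarrow> 0"
    by (intro tendsto_mult_right_zero lim_inverse_n)
  then show ?thesis using False Lim_null_comparison[OF always_eventually[OF allI[OF bd]]] by simp
qed

text \<open>
  Wiener's argument: the averages of the transform over the frequencies \<open>(K + n) *\<^sub>R b\<close>, \<open>n < N\<close>, with
  phases cancelling \<open>c\<close>, tend to the left-hand side for every \<open>K\<close>, so only the tail matters.
\<close>

lemma measure_hyperplanes_le:
  fixes b :: "'a::euclidean_space"
  assumes "prob_space \<mu>" and [measurable_cong]: "sets \<mu> = sets borel"
    and \<epsilon>: "\<And>n. n \<ge> K \<Longrightarrow> norm (fourier_transform \<mu> (real n *\<^sub>R b)) \<le> \<epsilon>"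
  shows "measure \<mu> {x. b \<bullet> (x - c) \<in> \<int>} \<le> \<epsilon>"
proof -
  interpret prob_space \<mu> by fact
  define e where "e \<theta> = exp (- 2 * of_real pi * \<i> * complex_of_real \<theta>)" for \<theta> :: real
  have e_add: "e (x + y) = e x * e y" for x y
    by (simp add: e_def algebra_simps flip: exp_add)
  have ne[simp]: "norm (e x) = 1" for x by (simp add: e_def norm_exp)
  have [measurable]: "e \<in> borel_measurable borel" unfolding e_def by measurable
  have [measurable]: "(\<int> :: real set) \<in> sets borel" by (intro borel_closed closed_Ints)
  let ?\<theta> = "\<lambda>x. b \<bullet> (x - c)"
  let ?s = "\<lambda>N x. e (real K * ?\<theta> x) * ((\<Sum>n<N. e (real n * ?\<theta> x)) / of_nat N)"
  have norm_s: "norm (?s N x) \<le> 1" for N x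
  proof -
    have "norm (\<Sum>n<N. e (real n * ?\<theta> x)) \<le> real N"
      using norm_sum[of "\<lambda>n. e (real n * ?\<theta> x)" "{..<N}"] by simp
    then show ?thesis by (cases "N = 0") (auto simp: norm_mult norm_divide)
  qed
  have int_e: "integrable \<mu> (\<lambda>x. e (f x))" if "f \<in> borel_measurable borel" for f
    by (intro integrable_const_bound[where B = 1]) (use that in auto)
  have "(\<lambda>N. LINT x|\<mu>. ?s N x) \<longlonglongrightarrow> (LINT x|\<mu>. indicator {x. ?\<theta> x \<in> \<int>} x)"
  proof (rule integral_dominated_convergence[where w = "\<lambda>_. 1"])
    show "AE x in \<mu>. (\<lambda>N. ?s N x) \<longlonglongrightarrow> indicator {x. ?\<theta> x \<in> \<int>} x"
    proof (intro AE_I2)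
      fix x
      have "(\<lambda>N. ?s N x) \<longlonglongrightarrow> e (real K * ?\<theta> x) * indicator \<int> (?\<theta> x)"
        unfolding e_def by (intro tendsto_mult tendsto_const geometric_mean_iexp_tendsto)
      \<comment> \<open>The factor that shifts the averaging window by \<open>K\<close> is invisible
        on the hyperplanes, and off them the limit is 0 anyway.\<close>
      moreover have "e (real K * ?\<theta> x) = 1" if "?\<theta> x \<in> \<int>"
      proof -
        from that obtain k where k: "?\<theta> x = of_int k" by (auto elim: Ints_cases)
        show ?thesis unfolding e_def exp_eq_1 k
          by (auto intro!: exI[of _ "- int K * k"])
      qed
      ultimately show "(\<lambda>N. ?s N x) \<longlonglongrightarrow> indicator {x. ?\<theta> x \<in> \<int>} x"
        by (auto split: split_indicator_asm split_indicator)
    qed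
  qed (use norm_s in auto)
  then have lim: "(\<lambda>N. norm (LINT x|\<mu>. ?s N x)) \<longlonglongrightarrow> norm (LINT x|\<mu>. indicator {x. ?\<theta> x \<in> \<int>} x :: complex)"
    by (rule tendsto_norm)
  have "norm (LINT x|\<mu>. ?s N x) \<le> \<epsilon>" if "N > 0" for N
  proof -
    \<comment> \<open>Each summand splits into a unimodular constant depending on \<open>c\<close>
      and a character in \<open>x\<close>, whose integral is a value of the transform at a frequency
      beyond \<open>K\<close>.\<close>
    have s: "?s N x = (\<Sum>n<N. e (- (real (K + n) * (b \<bullet> c))) * e ((real (K + n) *\<^sub>R b) \<bullet> x)) / of_nat N" for x
      by (simp add: sum_distrib_left flip: e_add) (simp add: algebra_simps)
    have "(LINT x|\<mu>. ?s N x) = (\<Sum>n<N. e (- (real (K + n) * (b \<bullet> c))) *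
        (LINT x|\<mu>. e ((real (K + n) *\<^sub>R b) \<bullet> x))) / of_nat N"
      unfolding s by (simp add: Bochner_Integration.integral_sum int_e del: inner_scaleR_left)
    also have "\<dots> = (\<Sum>n<N. e (- (real (K + n) * (b \<bullet> c))) * fourier_transform \<mu> (real (K + n) *\<^sub>R b)) / of_nat N"
      unfolding fourier_transform_def e_def ..
    also have "norm \<dots> \<le> (\<Sum>n<N. \<epsilon>) / real N"
      unfolding norm_divide norm_of_nat
      by (intro divide_right_mono sum_norm_le) (auto simp: norm_mult intro!: \<epsilon> simp del: of_nat_add)
    finally show ?thesis using that by simp
  qed
  then have "norm (LINT x|\<mu>. indicator {x. ?\<theta> x \<in> \<int>} x :: complex) \<le> \<epsilon>"
    by (intro tendsto_upperbound[OF lim]) (auto simp: eventually_at_top_linorder intro!: exI[of _ 1])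
  moreover have "(LINT x|\<mu>. indicator {x. ?\<theta> x \<in> \<int>} x :: complex) = of_real (measure \<mu> {x. ?\<theta> x \<in> \<int>})"
  proof -
    have "{x. ?\<theta> x \<in> \<int>} \<in> sets \<mu>" by measurable
    then have "(LINT x|\<mu>. indicator {x. ?\<theta> x \<in> \<int>} x) = measure \<mu> {x. ?\<theta> x \<in> \<int>}"
      by (simp add: Int_absorb2 sets.sets_into_space)
    then show ?thesis
      unfolding of_real_indicator[where 'a = complex, symmetric] integral_complex_of_real by simp
  qed
  ultimately show ?thesis by simp
qed

text \<open>The point \<open>c\<close> lies on the hyperplanes
  \<open>b \<bullet> (x - c) \<in> \<int>\<close>, whose total mass is at most any tail bound of the
  transform along the multiples of \<open>b\<close>.\<close>

lemma measure_singleton_eq_0: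
  fixes b :: "'a::euclidean_space"
  assumes \<mu>: "prob_space \<mu>" "sets \<mu> = sets borel"
    and lim: "(\<lambda>n. fourier_transform \<mu> (real n *\<^sub>R b)) \<longlonglongrightarrow> 0"
  shows "measure \<mu> {c} = 0"
proof -
  interpret prob_space \<mu> by fact
  have "measure \<mu> {c} \<le> 0 + \<epsilon>" if "\<epsilon> > 0" for \<epsilon>
  proof -
    obtain K where "\<And>n. n \<ge> K \<Longrightarrow> norm (fourier_transform \<mu> (real n *\<^sub>R b)) < \<epsilon>"
      using LIMSEQ_D[OF lim \<open>\<epsilon> > 0\<close>] by auto
    then have "measure \<mu> {x. b \<bullet> (x - c) \<in> \<int>} \<le> \<epsilon>"
      by (intro measure_hyperplanes_le[OF \<mu>]) (auto intro: less_imp_le)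
    moreover have "{x. b \<bullet> (x - c) \<in> \<int>} \<in> sets \<mu>"
    proof -
      have [measurable]: "(\<int> :: real set) \<in> sets borel" by (intro borel_closed closed_Ints)
      show ?thesis unfolding \<mu>(2) by measurable
    qed
    then have "measure \<mu> {c} \<le> measure \<mu> {x. b \<bullet> (x - c) \<in> \<int>}"
      by (intro finite_measure_mono) auto
    ultimately show ?thesis by simp
  qed
  then have "measure \<mu> {c} \<le> 0" by (rule field_le_epsilon)
  then show ?thesis by (simp add: measure_le_0_iff)
qed

section \<open>Cutoff functions on the line\<close>

lemma integrable_inverse_one_plus_abs_power:
  assumes "n \<ge> 2"
  shows "integrable lborel (\<lambda>t::real. 1 / (1 + \<bar>t\<bar>) ^ n)"
proof (rule Bochner_Integration.integrable_bound[OF integrable_inverse_one_plus_square])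
  have "1 / (1 + \<bar>t\<bar>) ^ n \<le> inverse (1 + t\<^sup>2)" for t :: real
  proof -
    have "1 + t\<^sup>2 \<le> (1 + \<bar>t\<bar>)\<^sup>2" by (simp add: power2_eq_square algebra_simps flip: abs_mult)
    also have "\<dots> \<le> (1 + \<bar>t\<bar>) ^ n" using assms by (intro power_increasing) auto
    finally have "inverse ((1 + \<bar>t\<bar>) ^ n) \<le> inverse (1 + t\<^sup>2)"
      by (intro le_imp_inverse_le) (auto intro: add_pos_nonneg)
    then show ?thesis by (simp add: divide_inverse)
  qed
  then show "AE t::real in lborel. norm (1 / (1 + \<bar>t\<bar>) ^ n) \<le> norm (inverse (1 + t\<^sup>2))"
    by simp
qed auto

lemma fourier_transform_eq_char: "fourier_transform M \<xi> = char M (- (2 * pi * \<xi>))"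
  by (simp add: fourier_transform_def char_def mult_ac)

text \<open>\<open>h y\<close> is the mass that \<open>M\<close>, concentrated on
  \<open>[-\<delta>/4, \<delta>/4]\<close>, gives to a window of half-width
  \<open>\<delta> / 2\<close> around \<open>y\<close>. For
  \<open>\<bar>y\<bar> < \<delta> / 4\<close> the window contains the support, and for
  \<open>\<bar>y\<bar> \<ge> \<delta>\<close> it misses it. The amplitude \<open>g\<close> inherits
  its decay from \<open>char M\<close>.\<close>

lemma cutoff_exists:
  assumes \<delta>: "\<delta> > 0" and n: "n \<ge> (2::nat)"
  shows "\<exists>(h :: real \<Rightarrow> real) g C. g \<in> borel_measurable borel \<and> (\<forall>t. norm (g t) \<le> C / (1 + \<bar>t\<bar>) ^ n) \<and>
    (\<forall>y. complex_of_real (h y) = (CLINT t|lborel. g t * iexp (- (t * y)))) \<and>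
    (\<forall>y. 0 \<le> h y \<and> h y \<le> 1) \<and> (\<forall>y. \<bar>y\<bar> < \<delta> / 4 \<longrightarrow> h y = 1) \<and> (\<forall>y. \<bar>y\<bar> \<ge> \<delta> \<longrightarrow> h y = 0)"
proof -
  \<comment> \<open>Chosen so that \<open>n\<close> summands bounded by \<open>r\<close> stay within
    \<open>\<delta> / 4\<close>.\<close>
  define r where "r = \<delta> / (4 * real n)"
  have r: "r > 0" and nr: "real n * r = \<delta> / 4" using \<delta> n by (auto simp: r_def)
  define U where "U = uniform_measure lborel {-r..r}"
  have "prob_space U" unfolding U_def using r by (intro prob_space_uniform_measure) auto
  then have U: "real_distribution U"
    by (intro real_distribution.intro real_distribution_axioms.intro) (auto simp: U_def)
  have "AE x in U. \<bar>x\<bar> \<le> r"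
    unfolding U_def by (intro AE_uniform_measureI) auto
  from real_distribution_iterated_convolution[OF U this, of n] obtain M
    where M: "real_distribution M" and supp: "AE x in M. \<bar>x\<bar> \<le> \<delta> / 4"
      and ch: "\<And>t. char M t = char U t ^ n"
    unfolding nr by blast
  interpret real_distribution M by fact
  define C where "C = (1 + 1 / r) ^ n"
  have C: "C \<ge> 0" unfolding C_def using r by simp
  have ch_le: "norm (char M t) \<le> C / (1 + \<bar>t\<bar>) ^ n" for t
  proof -
    have "norm (char U t) ^ n * (1 + \<bar>t\<bar>) ^ n \<le> C"
      unfolding C_def using norm_char_uniform_le[OF r]
      by (intro bounded_norm_char_power[OF U r]) (auto simp: U_def)
    moreover have "(1 + \<bar>t\<bar>) ^ n > 0" by (intro zero_less_power) auto
    ultimately show ?thesis by (simp add: ch norm_power pos_le_divide_eq)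
  qed
  have int: "integrable lborel (\<lambda>t. norm (char M t))"
  proof (rule Bochner_Integration.integrable_bound)
    show "integrable lborel (\<lambda>t. C * (1 / (1 + \<bar>t\<bar>) ^ n))"
      by (intro integrable_mult_right integrable_inverse_one_plus_abs_power n)
    show "AE t in lborel. norm (norm (char M t)) \<le> norm (C * (1 / (1 + \<bar>t\<bar>) ^ n))"
      using ch_le C by simp
  qed simp
  \<comment> \<open>The inversion formula needs this at the endpoints of the window. It follows from
    Wiener's argument in dimension one, since the transform of \<open>M\<close> decays along the
    integers.\<close>
  have atomless: "measure M {x} = 0" for x
  proof (rule measure_singleton_eq_0[where b = 1])
    have "norm (fourier_transform M (real k *\<^sub>R 1)) \<le> C * inverse (real k)" if "k \<ge> 1" for k
    proof -
      have "real k \<le> 1 + \<bar>- (2 * pi * real k)\<bar>"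
        using pi_gt3 mult_right_mono[of 1 "2 * pi" "real k"] by (simp add: abs_mult)
      also have "\<dots> \<le> (1 + \<bar>- (2 * pi * real k)\<bar>) ^ n"
        using n by (intro self_le_power) auto
      finally have "C / (1 + \<bar>- (2 * pi * real k)\<bar>) ^ n \<le> C / real k"
        using that C by (intro divide_left_mono) (auto intro!: mult_pos_pos zero_less_power add_pos_nonneg)
      with ch_le[of "- (2 * pi * real k)"] show ?thesis
        unfolding fourier_transform_eq_char by (simp add: divide_inverse)
    qed
    then have "\<forall>\<^sub>F k in sequentially. norm (fourier_transform M (real k *\<^sub>R 1)) \<le> C * inverse (real k)"
      unfolding eventually_sequentially by blast
    then show "(\<lambda>k. fourier_transform M (real k *\<^sub>R 1)) \<longlonglongrightarrow> 0"
      by (rule Lim_null_comparison) (intro tendsto_mult_right_zero lim_inverse_n)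
  qed (use prob_space_axioms in auto)
  define a where "a = \<delta> / 2"
  have a: "a > 0" using \<delta> by (simp add: a_def)
  define g where "g t = (iexp (t * a) - iexp (t * - a)) / (\<i> * t) * char M t / (2 * pi)" for t :: real
  define h where "h y = measure M {y - a<..y + a}" for y
  have "g \<in> borel_measurable borel" unfolding g_def by measurable
  moreover have "norm (g t) \<le> (2 * a / (2 * pi) * C) / (1 + \<bar>t\<bar>) ^ n" for t
  proof -
    have "norm (g t) = norm ((iexp (t * a) - iexp (t * - a)) / (\<i> * t)) * norm (char M t) / (2 * pi)"
      by (simp add: g_def norm_mult norm_divide)
    also have "\<dots> \<le> (2 * a) * (C / (1 + \<bar>t\<bar>) ^ n) / (2 * pi)"
      using interval_cutoff_kernel_bound[OF a, of t] ch_le[of t] a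
      by (intro divide_right_mono mult_mono) auto
    finally show ?thesis by (simp add: mult_ac)
  qed
  moreover have "complex_of_real (h y) = (CLINT t|lborel. g t * iexp (- (t * y)))" for y
    unfolding h_def g_def by (rule measure_interval_eq_integral[OF atomless a int])
  moreover have "0 \<le> h y \<and> h y \<le> 1" for y by (simp add: h_def)
  moreover have "h y = 1" if "\<bar>y\<bar> < \<delta> / 4" for y
    unfolding h_def a_def using that supp by (subst prob_eq_1) (auto elim!: eventually_mono)
  moreover have "h y = 0" if "\<bar>y\<bar> \<ge> \<delta>" for y
    unfolding h_def a_def using that supp \<delta>
    by (subst prob_eq_0) (auto elim!: eventually_mono)
  ultimately show ?thesis by blast
qed

section \<open>Decay under multiplication by cutoffs\<close>

text \<open>Peetre's inequality:
  \<open>1 + norm \<xi> \<le> (1 + norm (\<xi> + v)) * (1 + norm v)\<close> by the triangle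
  inequality, raised to the power \<open>s\<close>. It prices a translation of the
  frequency.\<close>

lemma powr_shift_le:
  fixes \<xi> v :: "'a::real_normed_vector"
  assumes "s \<ge> 0"
  shows "(1 + norm (\<xi> + v)) powr (- s) \<le> (1 + norm v) powr s * (1 + norm \<xi>) powr (- s)"
proof -
  have "norm \<xi> \<le> norm (\<xi> + v) + norm v"
    using norm_triangle_ineq4[of "\<xi> + v" v] by simp
  moreover have "0 \<le> norm (\<xi> + v) * norm v" by simp
  ultimately have "1 + norm \<xi> \<le> (1 + norm (\<xi> + v)) * (1 + norm v)"
    unfolding ring_distribs by linarith
  then have "(1 + norm \<xi>) powr s \<le> ((1 + norm (\<xi> + v)) * (1 + norm v)) powr s"
    using assms by (intro powr_mono2) auto
  also have "\<dots> = (1 + norm (\<xi> + v)) powr s * (1 + norm v) powr s"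
    by (simp add: powr_mult)
  finally have *: "(1 + norm \<xi>) powr s \<le> (1 + norm (\<xi> + v)) powr s * (1 + norm v) powr s" .
  have pos: "(1 + norm x) powr s > 0" for x :: 'a
    using norm_ge_zero[of x] by (intro powr_gt_zero[THEN iffD2]) linarith
  have "inverse y \<le> w * inverse x" if "x \<le> y * w" "x > 0" "y > 0" for x y w :: real
    using that by (simp add: field_simps)
  from this[OF * pos pos] show ?thesis by (simp only: powr_minus)
qed

text \<open>The transform of the measure with density \<open>f\<close>, kept unnormalised so that
  weights can be multiplied one after another without asking whether their mass is positive.\<close>

definition weighted_transform :: "'a::euclidean_space measure \<Rightarrow> ('a \<Rightarrow> real) \<Rightarrow> 'a \<Rightarrow> complex" where
  "weighted_transform \<mu> f \<xi> =
     (LINT x|\<mu>. complex_of_real (f x) * exp (- 2 * complex_of_real pi * \<i> * complex_of_real (\<xi> \<bullet> x)))"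

text \<open>The base \<open>1 + norm \<xi>\<close> avoids an exception at the origin and suits the
  shift inequality. The exponent is not halved: \<open>fourier_decay\<close> of order
  \<open>s\<close> corresponds to order \<open>s / 2\<close> here.\<close>

definition weighted_decay :: "'a::euclidean_space measure \<Rightarrow> ('a \<Rightarrow> real) \<Rightarrow> real \<Rightarrow> bool" where
  "weighted_decay \<mu> f s \<longleftrightarrow>
     (\<exists>C. \<forall>\<xi>. norm (weighted_transform \<mu> f \<xi>) \<le> C * (1 + norm \<xi>) powr (- s))"

text \<open>By Fubini the new transform is the old one averaged over translates along
  \<open>b\<close> with amplitude \<open>g\<close>. A translate with parameter \<open>t\<close>
  costs at most \<open>(1 + \<bar>t\<bar>) powr s\<close>; since \<open>s + 2 \<le> real n\<close>,
  the decay of \<open>g\<close> pays for it and leaves the integrable factor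
  \<open>1 / (1 + \<bar>t\<bar>) ^ 2\<close>.\<close>

lemma weighted_decay_mult_cutoff:
  fixes b :: "'a::euclidean_space" and g :: "real \<Rightarrow> complex"
  assumes \<mu>: "prob_space \<mu>" and [measurable_cong]: "sets \<mu> = sets borel"
    and [measurable]: "f \<in> borel_measurable borel" and f1: "\<And>x. \<bar>f x\<bar> \<le> 1"
    and decay: "weighted_decay \<mu> f s" and s: "0 \<le> s" "s + 2 \<le> real n"
    and b: "norm b = 1"
    and [measurable]: "g \<in> borel_measurable borel" and g: "\<And>t. norm (g t) \<le> K / (1 + \<bar>t\<bar>) ^ n"
    and h: "\<And>y. complex_of_real (h y) = (CLINT t|lborel. g t * iexp (- (t * y)))"
  shows "weighted_decay \<mu> (\<lambda>x. f x * h (x \<bullet> b - c)) s"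
proof -
  interpret prob_space \<mu> by fact
  interpret P: pair_sigma_finite lborel \<mu> ..
  from decay obtain C where C: "\<And>\<xi>. norm (weighted_transform \<mu> f \<xi>) \<le> C * (1 + norm \<xi>) powr (- s)"
    unfolding weighted_decay_def by blast
  have C0: "C \<ge> 0" using C[of 0] order_trans[OF norm_ge_zero] by fastforce
  have K0: "K \<ge> 0" using g[of 0] order_trans[OF norm_ge_zero] by fastforce
  have "n \<ge> 2" using s by linarith
  note int_n = integrable_inverse_one_plus_abs_power[OF this]
  have int_g: "integrable lborel (\<lambda>t. norm (g t))"
    by (rule Bochner_Integration.integrable_bound[OF integrable_mult_right[OF int_n, of K]])
       (use g K0 in auto)
  define e where "e \<xi> x = exp (- 2 * complex_of_real pi * \<i> * complex_of_real (\<xi> \<bullet> x))" for \<xi> x :: 'a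
  have [measurable]: "e \<xi> \<in> borel_measurable borel" for \<xi> unfolding e_def by measurable
  have ne: "norm (e \<xi> x) = 1" for \<xi> x by (simp add: e_def norm_exp)
  have int_f: "integrable \<mu> (\<lambda>x. \<bar>f x\<bar>)"
    by (intro integrable_const_bound[where B = 1]) (use f1 in auto)
  have eq: "weighted_transform \<mu> (\<lambda>x. f x * h (x \<bullet> b - c)) \<xi> =
    (CLINT t|lborel. g t * iexp (t * c) * weighted_transform \<mu> f (\<xi> + (t / (2 * pi)) *\<^sub>R b))" for \<xi>
  proof -
    let ?F = "\<lambda>t x. f x * e \<xi> x * (g t * iexp (- (t * (x \<bullet> b - c))))"
    have nF: "norm (?F t x) = norm (g t) * \<bar>f x\<bar>" for t x
      by (simp add: norm_mult ne)
    have "integrable (lborel \<Otimes>\<^sub>M \<mu>) (\<lambda>(t, x). ?F t x)"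
    proof (rule P.Fubini_integrable)
      show "integrable lborel (\<lambda>t. LINT x|\<mu>. norm (case (t, x) of (t, x) \<Rightarrow> ?F t x))"
        unfolding prod.case nF by (simp add: int_g)
      show "AE t in lborel. integrable \<mu> (\<lambda>x. case (t, x) of (t, x) \<Rightarrow> ?F t x)"
      proof (intro AE_I2)
        fix t
        show "integrable \<mu> (\<lambda>x. case (t, x) of (t, x) \<Rightarrow> ?F t x)"
          unfolding prod.case
          by (rule Bochner_Integration.integrable_bound[OF integrable_mult_right[OF int_f, of "norm (g t)"]], measurable)
             (simp only: nF, simp)
      qed
    qed measurable
    from P.Fubini_integral[OF this]
    have "(LINT x|\<mu>. LINT t|lborel. ?F t x) = (LINT t|lborel. LINT x|\<mu>. ?F t x)" .
    moreover have "(LINT x|\<mu>. LINT t|lborel. ?F t x) = weighted_transform \<mu> (\<lambda>x. f x * h (x \<bullet> b - c)) \<xi>"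
      unfolding weighted_transform_def integral_mult_right_zero h[symmetric] e_def
      by (simp add: mult_ac)
    moreover have "(LINT x|\<mu>. ?F t x) = g t * iexp (t * c) * weighted_transform \<mu> f (\<xi> + (t / (2 * pi)) *\<^sub>R b)" for t
    proof -
      have Fx: "?F t x = g t * iexp (t * c) * (f x * e (\<xi> + (t / (2 * pi)) *\<^sub>R b) x)" for x
      proof -
        \<comment> \<open>The divisor \<open>2 * pi\<close> converts between the two normalisations
          of characters; \<open>c\<close> contributes only a phase of modulus 1.\<close>
        have "e \<xi> x * iexp (- (t * (x \<bullet> b - c))) = iexp (t * c) * e (\<xi> + (t / (2 * pi)) *\<^sub>R b) x"
          unfolding e_def by (simp add: inner_add_left algebra_simps inner_commute flip: exp_add)
        then show ?thesis by (simp add: mult_ac)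
      qed
      show ?thesis unfolding weighted_transform_def e_def[symmetric] Fx integral_mult_right_zero ..
    qed
    ultimately show ?thesis by (simp only:)
  qed
  show ?thesis unfolding weighted_decay_def
  proof (intro exI allI)
    fix \<xi>
    have bound: "norm (g t * iexp (t * c) * weighted_transform \<mu> f (\<xi> + (t / (2 * pi)) *\<^sub>R b))
      \<le> (C * (1 + norm \<xi>) powr (- s)) * K * (1 / (1 + \<bar>t\<bar>) ^ 2)" for t
    proof -
      have "norm ((t / (2 * pi)) *\<^sub>R b) \<le> \<bar>t\<bar>"
        using b pi_gt3 mult_left_mono[of 1 "2 * pi" "\<bar>t\<bar>"] by (simp add: divide_le_eq)
      then have "(1 + norm ((t / (2 * pi)) *\<^sub>R b)) powr s \<le> (1 + \<bar>t\<bar>) powr s"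
        using s by (intro powr_mono2) auto
      then have "(1 + norm (\<xi> + (t / (2 * pi)) *\<^sub>R b)) powr (- s) \<le> (1 + \<bar>t\<bar>) powr s * (1 + norm \<xi>) powr (- s)"
        using powr_shift_le[OF s(1), of \<xi> "(t / (2 * pi)) *\<^sub>R b"]
        by (meson order_trans mult_right_mono powr_ge_zero)
      then have w: "norm (weighted_transform \<mu> f (\<xi> + (t / (2 * pi)) *\<^sub>R b)) \<le>
          C * ((1 + \<bar>t\<bar>) powr s * (1 + norm \<xi>) powr (- s))"
        using C C0 by (meson order_trans mult_left_mono)
      have "(1 + \<bar>t\<bar>) powr s \<le> (1 + \<bar>t\<bar>) powr (real n - 2)"
        using s by (intro powr_mono) auto
      also have "\<dots> = (1 + \<bar>t\<bar>) ^ n / (1 + \<bar>t\<bar>) ^ 2"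
        by (simp add: powr_diff powr_realpow add_pos_nonneg)
      finally have p: "(1 + \<bar>t\<bar>) powr s \<le> (1 + \<bar>t\<bar>) ^ n / (1 + \<bar>t\<bar>) ^ 2" .
      have "norm (g t * iexp (t * c) * weighted_transform \<mu> f (\<xi> + (t / (2 * pi)) *\<^sub>R b)) =
          norm (g t) * norm (weighted_transform \<mu> f (\<xi> + (t / (2 * pi)) *\<^sub>R b))"
        by (simp only: norm_mult norm_exp_i_times mult_1_right)
      also have "\<dots> \<le> K / (1 + \<bar>t\<bar>) ^ n * (C * ((1 + \<bar>t\<bar>) powr s * (1 + norm \<xi>) powr (- s)))"
        using g w K0 by (intro mult_mono) auto
      also have "\<dots> \<le> K / (1 + \<bar>t\<bar>) ^ n * (C * ((1 + \<bar>t\<bar>) ^ n / (1 + \<bar>t\<bar>) ^ 2 * (1 + norm \<xi>) powr (- s)))"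
        using p K0 C0 by (intro mult_left_mono mult_right_mono) auto
      also have "\<dots> = (C * (1 + norm \<xi>) powr (- s)) * K * (1 / (1 + \<bar>t\<bar>) ^ 2)"
        by (simp add: field_simps add_pos_nonneg)
      finally show ?thesis .
    qed
    have int2: "integrable lborel (\<lambda>t. (C * (1 + norm \<xi>) powr (- s)) * K * (1 / (1 + \<bar>t\<bar>) ^ 2))"
      by (intro integrable_mult_right integrable_inverse_one_plus_abs_power) simp
    have "norm (weighted_transform \<mu> (\<lambda>x. f x * h (x \<bullet> b - c)) \<xi>)
      \<le> (LINT t|lborel. (C * (1 + norm \<xi>) powr (- s)) * K * (1 / (1 + \<bar>t\<bar>) ^ 2))"
      unfolding eq by (intro order_trans[OF integral_norm_bound integral_mono'] bound int2) (use C0 K0 in auto)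
    also have "\<dots> = C * K * (LINT t|lborel. 1 / (1 + \<bar>t::real\<bar>) ^ 2) * (1 + norm \<xi>) powr (- s)"
      by (simp only: integral_mult_right_zero) (simp add: mult_ac)
    finally show "norm (weighted_transform \<mu> (\<lambda>x. f x * h (x \<bullet> b - c)) \<xi>)
      \<le> C * K * (LINT t|lborel. 1 / (1 + \<bar>t::real\<bar>) ^ 2) * (1 + norm \<xi>) powr (- s)" .
  qed
qed

text \<open>The weight is a product of one-dimensional cutoffs, one per coordinate. Induction over
  the coordinates inserts the factors singly, each preserving the decay.\<close>

lemma cutoff_decay_exists:
  fixes \<mu> :: "'a::euclidean_space measure"
  assumes \<mu>: "prob_space \<mu>" "sets \<mu> = sets borel"
    and decay: "weighted_decay \<mu> (\<lambda>_. 1) s" and s: "s \<ge> 0" and \<delta>: "\<delta> > 0"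
  shows "\<exists>f. f \<in> borel_measurable borel \<and> (\<forall>x. 0 \<le> f x \<and> f x \<le> 1) \<and> weighted_decay \<mu> f s \<and>
    (\<forall>x. (\<forall>b\<in>Basis. \<bar>(x - c) \<bullet> b\<bar> < \<delta> / 4) \<longrightarrow> f x = 1) \<and>
    (\<forall>x. (\<exists>b\<in>Basis. \<bar>(x - c) \<bullet> b\<bar> \<ge> \<delta>) \<longrightarrow> f x = 0)"
proof -
  obtain n :: nat where n: "s + 2 \<le> real n" using real_arch_simple by blast
  then have "n \<ge> 2" using s by linarith
  from cutoff_exists[OF \<delta> this] obtain h :: "real \<Rightarrow> real" and g K where
    g[measurable]: "g \<in> borel_measurable borel" and gK: "\<And>t. norm (g t) \<le> K / (1 + \<bar>t\<bar>) ^ n"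
    and hg: "\<And>y. complex_of_real (h y) = (CLINT t|lborel. g t * iexp (- (t * y)))"
    and h: "\<And>y. 0 \<le> h y" "\<And>y. h y \<le> 1" "\<And>y. \<bar>y\<bar> < \<delta> / 4 \<Longrightarrow> h y = 1" "\<And>y. \<bar>y\<bar> \<ge> \<delta> \<Longrightarrow> h y = 0"
    by blast
  \<comment> \<open>Measurability of \<open>h\<close> is read off its representation as a parameter
    integral.\<close>
  have "h = (\<lambda>y. Re (CLINT t|lborel. g t * iexp (- (t * y))))"
    unfolding hg[symmetric] by simp
  also have "\<dots> \<in> borel_measurable borel" by measurable
  finally have [measurable]: "h \<in> borel_measurable borel" .
  define f where "f B x = (\<Prod>b\<in>B. h (x \<bullet> b - c \<bullet> b))" for B x
  have f_meas: "f B \<in> borel_measurable borel" for B unfolding f_def by measurable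
  have f01: "0 \<le> f B x \<and> f B x \<le> 1" for B x
    unfolding f_def by (intro conjI prod_nonneg prod_le_1) (use h in auto)
  have dec: "weighted_decay \<mu> (f B) s" if "finite B" "B \<subseteq> Basis" for B
    using that
  proof (induction B rule: finite_induct)
    case empty
    then show ?case using decay by (simp add: f_def)
  next
    case (insert b B)
    have "f (insert b B) = (\<lambda>x. f B x * h (x \<bullet> b - c \<bullet> b))"
      using insert by (auto simp: f_def fun_eq_iff)
    moreover have "weighted_decay \<mu> (\<lambda>x. f B x * h (x \<bullet> b - c \<bullet> b)) s"
      by (rule weighted_decay_mult_cutoff[OF \<mu> f_meas _ _ s n _ g gK hg])
         (use insert f01 in auto)
    ultimately show ?case by simp
  qed
  have "f Basis x = 1" if "\<forall>b\<in>Basis. \<bar>(x - c) \<bullet> b\<bar> < \<delta> / 4" for x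
    unfolding f_def using that by (intro prod.neutral) (auto simp: inner_diff_left h)
  moreover have "f Basis x = 0" if "\<exists>b\<in>Basis. \<bar>(x - c) \<bullet> b\<bar> \<ge> \<delta>" for x
    unfolding f_def using that by (intro prod_zero) (force simp: inner_diff_left intro: h)+
  ultimately show ?thesis using f_meas[of Basis] f01[of Basis] dec[OF finite_Basis subset_refl]
    by (intro exI[of _ "f Basis"]) simp
qed

section \<open>Passing between decay of measures and decay of weights\<close>

lemma norm_fourier_transform_le_1:
  assumes "prob_space \<mu>"
  shows "norm (fourier_transform \<mu> \<xi>) \<le> 1"
proof -
  interpret prob_space \<mu> by fact
  have "norm (fourier_transform \<mu> \<xi>) \<le> (LINT x|\<mu>. norm (exp (- 2 * complex_of_real pi * \<i> * complex_of_real (\<xi> \<bullet> x))))"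
    unfolding fourier_transform_def by (rule integral_norm_bound)
  also have "\<dots> = 1" by (simp add: norm_exp prob_space)
  finally show ?thesis .
qed

text \<open>Outside the unit ball \<open>norm \<xi> \<ge> (1 + norm \<xi>) / 2\<close>, so the given
  decay transfers. Inside it the trivial bound 1 suffices, because the negative power of
  \<open>(1 + norm \<xi>) / 2\<close> is at least 1. The constant \<open>\<bar>C\<bar> + 1\<close>
  serves both cases.\<close>

lemma weighted_decay_1_if_fourier_decay:
  assumes \<mu>: "prob_space \<mu>" and decay: "fourier_decay \<mu> s" and s: "s \<ge> 0"
  shows "weighted_decay \<mu> (\<lambda>_. 1) (s / 2)"
proof -
  from decay obtain C where C: "\<And>\<xi>. \<xi> \<noteq> 0 \<Longrightarrow> norm (fourier_transform \<mu> \<xi>) \<le> C * norm \<xi> powr (- s / 2)"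
    unfolding fourier_decay_def by blast
  have "norm (fourier_transform \<mu> \<xi>) \<le> ((\<bar>C\<bar> + 1) * 2 powr (s / 2)) * (1 + norm \<xi>) powr (- (s / 2))" for \<xi>
  proof -
    have "norm (fourier_transform \<mu> \<xi>) \<le> (\<bar>C\<bar> + 1) * ((1 + norm \<xi>) / 2) powr (- (s / 2))"
    proof (cases "norm \<xi> \<ge> 1")
      case True
      then have "norm (fourier_transform \<mu> \<xi>) \<le> C * norm \<xi> powr (- s / 2)" by (intro C) auto
      also have "\<dots> \<le> (\<bar>C\<bar> + 1) * norm \<xi> powr (- s / 2)" by (intro mult_right_mono) auto
      also have "\<dots> \<le> (\<bar>C\<bar> + 1) * ((1 + norm \<xi>) / 2) powr (- s / 2)"
        using True s by (intro mult_left_mono powr_mono2') (auto intro: add_pos_nonneg)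
      finally show ?thesis by simp
    next
      case False
      have "norm (fourier_transform \<mu> \<xi>) \<le> 1" by (rule norm_fourier_transform_le_1[OF \<mu>])
      also have "1 = 1 powr (- (s / 2))" by simp
      also have "\<dots> \<le> ((1 + norm \<xi>) / 2) powr (- (s / 2))"
        using False s by (intro powr_mono2') (auto intro: add_pos_nonneg)
      also have "\<dots> \<le> (\<bar>C\<bar> + 1) * ((1 + norm \<xi>) / 2) powr (- (s / 2))"
        using mult_right_mono[of 1 "\<bar>C\<bar> + 1" "((1 + norm \<xi>) / 2) powr (- (s / 2))"] by simp
      finally show ?thesis .
    qed
    also have "((1 + norm \<xi>) / 2) powr (- (s / 2)) = 2 powr (s / 2) * (1 + norm \<xi>) powr (- (s / 2))"
      by (simp add: powr_divide powr_minus field_simps)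
    finally show ?thesis by (simp add: mult_ac)
  qed
  then show ?thesis
    unfolding weighted_decay_def weighted_transform_def fourier_transform_def by auto
qed

text \<open>Dividing the weight by its mass \<open>m\<close> yields a probability density, and the
  transform changes only by the factor \<open>1 / m\<close>. Replacing \<open>1 + norm \<xi>\<close>
  by \<open>norm \<xi>\<close> under a nonpositive exponent only enlarges the bound.\<close>

lemma density_in_borel_prob_on:
  fixes \<mu> :: "'a::euclidean_space measure"
  assumes \<mu>: "prob_space \<mu>" and [measurable_cong]: "sets \<mu> = sets borel"
    and [measurable]: "f \<in> borel_measurable borel" and f: "\<And>x. 0 \<le> f x" "\<And>x. f x \<le> 1"
    and decay: "weighted_decay \<mu> f (t / 2)" and t: "t \<ge> 0"
    and pos: "(LINT x|\<mu>. f x) > 0"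
    and [measurable]: "A \<in> sets borel" and A: "AE x in \<mu>. f x \<noteq> 0 \<longrightarrow> x \<in> A"
  shows "\<exists>\<nu>\<in>borel_prob_on A. fourier_decay \<nu> t"
proof -
  interpret prob_space \<mu> by fact
  define m where "m = (LINT x|\<mu>. f x)"
  have m: "m > 0" using pos by (simp add: m_def)
  define \<nu> where "\<nu> = density \<mu> (\<lambda>x. ennreal (f x / m))"
  have int: "integrable \<mu> f" by (intro integrable_const_bound[where B = 1]) (use f in auto)
  have "emeasure \<nu> (space \<nu>) = (\<integral>\<^sup>+x. ennreal (f x / m) \<partial>\<mu>)"
    unfolding \<nu>_def by (subst emeasure_density) (auto simp: nn_integral_set_ennreal intro!: nn_integral_cong)
  also have "\<dots> = ennreal (LINT x|\<mu>. f x / m)"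
    using int f m by (intro nn_integral_eq_integral) auto
  also have "(LINT x|\<mu>. f x / m) = 1" using m by (simp add: m_def)
  finally have "prob_space \<nu>" by (intro prob_spaceI) simp
  moreover have s\<nu>: "sets \<nu> = sets borel" by (simp add: \<nu>_def assms(2))
  moreover have "measure \<nu> A = 1"
  proof -
    interpret \<nu>: prob_space \<nu> by fact
    have "AE x in \<nu>. x \<in> A" unfolding \<nu>_def
      using A m f(1) by (subst AE_density) (auto elim!: eventually_mono simp: order_less_le)
    then show ?thesis by (subst \<nu>.prob_eq_1) (auto simp: s\<nu>)
  qed
  moreover have "fourier_decay \<nu> t"
  proof -
    from decay obtain C where C: "\<And>\<xi>. norm (weighted_transform \<mu> f \<xi>) \<le> C * (1 + norm \<xi>) powr (- (t / 2))"
      unfolding weighted_decay_def by auto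
    have C0: "C \<ge> 0" using C[of 0] order_trans[OF norm_ge_zero] by fastforce
    have "norm (fourier_transform \<nu> \<xi>) \<le> C / m * norm \<xi> powr (- t / 2)" if "\<xi> \<noteq> 0" for \<xi>
    proof -
      have "fourier_transform \<nu> \<xi> = (LINT x|\<mu>. (f x / m) *\<^sub>R exp (- 2 * complex_of_real pi * \<i> * complex_of_real (\<xi> \<bullet> x)))"
        unfolding fourier_transform_def \<nu>_def using f m by (subst integral_density) auto
      also have "\<dots> = weighted_transform \<mu> f \<xi> / m"
        unfolding weighted_transform_def by (simp add: scaleR_conv_of_real)
      finally have "norm (fourier_transform \<nu> \<xi>) = norm (weighted_transform \<mu> f \<xi>) / m"
        using m by (simp add: norm_divide)
      also have "\<dots> \<le> C * (1 + norm \<xi>) powr (- (t / 2)) / m"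
        using C m by (intro divide_right_mono) auto
      also have "\<dots> \<le> C * norm \<xi> powr (- (t / 2)) / m"
        using m C0 t that by (intro divide_right_mono mult_left_mono powr_mono2') auto
      finally show ?thesis by simp
    qed
    then show ?thesis unfolding fourier_decay_def by blast
  qed
  ultimately show ?thesis unfolding borel_prob_on_def by blast
qed

section \<open>Elementary properties of Fourier dimension\<close>

lemma decay_set_bounded: "bdd_above {s \<in> {0..real DIM('a::euclidean_space)}. fourier_decay (\<mu> :: 'a measure) s}"
  by (rule bdd_aboveI[of _ "real DIM('a)"]) auto

lemma fourier_decay_0:
  assumes "prob_space \<mu>"
  shows "fourier_decay \<mu> 0"
  unfolding fourier_decay_def using norm_fourier_transform_le_1[OF assms] by (auto intro!: exI[of _ 1])

lemma fourier_dim_measure_ge: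
  fixes \<mu> :: "'a::euclidean_space measure"
  assumes "fourier_decay \<mu> s" "0 \<le> s" "s \<le> real DIM('a)"
  shows "s \<le> fourier_dim_measure \<mu>"
  unfolding fourier_dim_measure_def dim_Sup_def
  using assms decay_set_bounded by (auto intro!: cSup_upper)

lemma fourier_dim_measure_range:
  fixes \<mu> :: "'a::euclidean_space measure"
  assumes "prob_space \<mu>"
  shows "0 \<le> fourier_dim_measure \<mu>" "fourier_dim_measure \<mu> \<le> real DIM('a)"
proof -
  show "0 \<le> fourier_dim_measure \<mu>"
    by (intro fourier_dim_measure_ge fourier_decay_0 assms) auto
  have "0 \<in> {s \<in> {0..real DIM('a)}. fourier_decay \<mu> s}" using fourier_decay_0[OF assms] by simp
  then have "{s \<in> {0..real DIM('a)}. fourier_decay \<mu> s} \<noteq> {}" by blast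
  then show "fourier_dim_measure \<mu> \<le> real DIM('a)"
    unfolding fourier_dim_measure_def dim_Sup_def by (auto intro!: cSup_least)
qed

lemma fourier_dim_ge:
  fixes A :: "'a::euclidean_space set"
  assumes "\<mu> \<in> borel_prob_on A"
  shows "fourier_dim_measure \<mu> \<le> fourier_dim A"
proof -
  have "bdd_above (fourier_dim_measure ` borel_prob_on A)"
    using fourier_dim_measure_range(2) by (intro bdd_aboveI[of _ "real DIM('a)"]) (auto simp: borel_prob_on_def)
  with assms show ?thesis unfolding fourier_dim_def dim_Sup_def by (auto intro!: cSup_upper)
qed

text \<open>Nonnegativity of \<open>s\<close> covers the case that \<open>A\<close> carries no
  probability measure, where the supremum is 0 by convention.\<close>

lemma fourier_dim_le:
  assumes "\<And>\<mu>. \<mu> \<in> borel_prob_on A \<Longrightarrow> fourier_dim_measure \<mu> \<le> s" "0 \<le> s"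
  shows "fourier_dim A \<le> s"
  unfolding fourier_dim_def dim_Sup_def using assms by (auto intro!: cSup_least)

lemma fourier_dim_range:
  fixes A :: "'a::euclidean_space set"
  shows "0 \<le> fourier_dim A" "fourier_dim A \<le> real DIM('a)"
proof -
  show "0 \<le> fourier_dim A"
  proof (cases "borel_prob_on A = {}")
    case False
    then obtain \<mu> where \<mu>: "\<mu> \<in> borel_prob_on A" by blast
    then have "0 \<le> fourier_dim_measure \<mu>"
      by (intro fourier_dim_measure_range) (simp add: borel_prob_on_def)
    also have "\<dots> \<le> fourier_dim A" by (rule fourier_dim_ge[OF \<mu>])
    finally show ?thesis .
  qed (simp add: fourier_dim_def dim_Sup_def)
  show "fourier_dim A \<le> real DIM('a)"
    by (rule fourier_dim_le) (auto simp: borel_prob_on_def intro: fourier_dim_measure_range)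
qed

lemma fourier_dim_mono:
  fixes A B :: "'a::euclidean_space set"
  assumes "A \<subseteq> B" "A \<in> sets borel" "B \<in> sets borel"
  shows "fourier_dim A \<le> fourier_dim B"
proof (rule fourier_dim_le)
  fix \<mu> assume \<mu>: "\<mu> \<in> borel_prob_on A"
  then interpret prob_space \<mu> by (simp add: borel_prob_on_def)
  have "prob A \<le> prob B"
    using \<mu> assms by (intro finite_measure_mono) (auto simp: borel_prob_on_def)
  then have "prob B = 1" using \<mu> by (intro antisym prob_le_1) (simp add: borel_prob_on_def)
  with \<mu> have "\<mu> \<in> borel_prob_on B" by (simp add: borel_prob_on_def)
  then show "fourier_dim_measure \<mu> \<le> fourier_dim B" by (rule fourier_dim_ge)
qed (rule fourier_dim_range)

section \<open>Null sets and localization\<close>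

text \<open>Positive order of decay makes the transform vanish at infinity along the multiples of a
  basis vector, so there are no atoms, and a countable set is a countable union of null
  singletons.\<close>

lemma fourier_decay_countable_null:
  fixes \<mu> :: "'a::euclidean_space measure"
  assumes \<mu>: "prob_space \<mu>" "sets \<mu> = sets borel"
    and decay: "fourier_decay \<mu> s" and s: "s > 0" and S: "countable S"
  shows "measure \<mu> S = 0"
proof -
  interpret prob_space \<mu> by fact
  obtain b :: 'a where b: "b \<in> Basis" using nonempty_Basis by blast
  from decay obtain C where C: "\<And>\<xi>. \<xi> \<noteq> 0 \<Longrightarrow> norm (fourier_transform \<mu> \<xi>) \<le> C * norm \<xi> powr (- s / 2)"
    unfolding fourier_decay_def by blast
  have "norm (fourier_transform \<mu> (real n *\<^sub>R b)) \<le> C * real n powr (- s / 2)" if "n \<ge> 1" for n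
    using C[of "real n *\<^sub>R b"] b that nonzero_Basis[OF b] by auto
  then have "\<forall>\<^sub>F n in sequentially. norm (fourier_transform \<mu> (real n *\<^sub>R b)) \<le> C * real n powr (- s / 2)"
    unfolding eventually_sequentially by blast
  moreover have "(\<lambda>n. C * real n powr (- s / 2)) \<longlonglongrightarrow> 0"
    using s by (intro tendsto_mult_right_zero tendsto_neg_powr filterlim_real_sequentially) auto
  ultimately have "(\<lambda>n. fourier_transform \<mu> (real n *\<^sub>R b)) \<longlonglongrightarrow> 0"
    by (rule Lim_null_comparison)
  then have "measure \<mu> {x} = 0" for x by (rule measure_singleton_eq_0[OF \<mu>])
  then have "{x} \<in> null_sets \<mu>" for x by (auto simp: \<mu>(2) null_sets_def emeasure_eq_measure)
  then have "(\<Union>x\<in>S. {x}) \<in> null_sets \<mu>" using S by (intro null_sets_UN') auto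
  then show ?thesis by (simp add: null_sets_def measure_def)
qed

text \<open>Otherwise the null open sets cover \<open>U\<close>; by Lindelof countably many of them
  do, and \<open>U\<close> would be null.\<close>

lemma exists_point_of_support:
  fixes U :: "'a::{second_countable_topology} set"
  assumes sets: "sets \<mu> = sets borel" and U: "open U" "emeasure \<mu> U \<noteq> 0"
  shows "\<exists>c\<in>U. \<forall>V. open V \<and> c \<in> V \<longrightarrow> emeasure \<mu> V \<noteq> 0"
proof (rule ccontr)
  assume neg: "\<not> ?thesis"
  let ?F = "{V. open V \<and> emeasure \<mu> V = 0}"
  obtain F' where F': "F' \<subseteq> ?F" "countable F'" "\<Union>F' = \<Union>?F"
    using Lindelof[of ?F] by blast
  have "(\<Union>V\<in>F'. V) \<in> null_sets \<mu>"
    using F' by (intro null_sets_UN') (auto simp: null_sets_def sets)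
  moreover have "U \<subseteq> \<Union>F'" unfolding F'(3) using neg by blast
  ultimately have "U \<in> null_sets \<mu>"
    using U sets by (auto intro: null_sets_subset)
  with U show False by (simp add: null_sets_def)
qed

text \<open>A cutoff centred at a point of the support inside \<open>U\<close> has positive
  integral, and if it is narrow enough it vanishes off \<open>U\<close>, so the normalised weighted
  measure lives on \<open>A\<close>.\<close>

lemma fourier_decay_localize:
  fixes \<mu> :: "'a::euclidean_space measure"
  assumes \<mu>: "prob_space \<mu>" "sets \<mu> = sets borel"
    and decay: "fourier_decay \<mu> t" and t: "t \<ge> 0"
    and U: "open U" "emeasure \<mu> U \<noteq> 0"
    and A: "A \<in> sets borel" "AE x in \<mu>. x \<in> U \<longrightarrow> x \<in> A"
  shows "\<exists>\<nu>\<in>borel_prob_on A. fourier_decay \<nu> t"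
proof -
  interpret prob_space \<mu> by fact
  obtain c where c: "c \<in> U" "\<And>V. open V \<Longrightarrow> c \<in> V \<Longrightarrow> emeasure \<mu> V \<noteq> 0"
    using exists_point_of_support[OF \<mu>(2) U] by blast
  obtain \<epsilon> where \<epsilon>: "\<epsilon> > 0" "ball c \<epsilon> \<subseteq> U" using U(1) c(1) open_contains_ball by blast
  \<comment> \<open>The weight vanishes off a cube of half-side \<open>\<delta>\<close>; by the l1
    bound on the norm that cube lies in the ball of radius \<open>\<epsilon>\<close>.\<close>
  define \<delta> where "\<delta> = \<epsilon> / real DIM('a)"
  have \<delta>: "\<delta> > 0" using \<epsilon> by (simp add: \<delta>_def)
  have w: "weighted_decay \<mu> (\<lambda>_. 1) (t / 2)" by (rule weighted_decay_1_if_fourier_decay[OF \<mu>(1) decay t])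
  obtain f where f: "f \<in> borel_measurable borel" "\<And>x. 0 \<le> f x" "\<And>x. f x \<le> 1" "weighted_decay \<mu> f (t / 2)"
    and f1: "\<And>x. \<forall>b\<in>Basis. \<bar>(x - c) \<bullet> b\<bar> < \<delta> / 4 \<Longrightarrow> f x = 1"
    and f0: "\<And>x. \<exists>b\<in>Basis. \<bar>(x - c) \<bullet> b\<bar> \<ge> \<delta> \<Longrightarrow> f x = 0"
    using cutoff_decay_exists[OF \<mu> w _ \<delta>, of c] t by (auto simp del: split_paired_All)
  show ?thesis
  proof (rule density_in_borel_prob_on[OF \<mu> f(1-4) t _ A(1)])
    have int: "integrable \<mu> f"
      by (intro integrable_const_bound[where B = 1]) (use f in \<open>auto simp: measurable_cong_sets[OF \<mu>(2) refl]\<close>)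
    \<comment> \<open>This ball lies in the cube where the weight is 1, so its mass bounds the
      integral from below.\<close>
    have "emeasure \<mu> (ball c (\<delta> / 4)) \<noteq> 0" using \<delta> by (intro c) auto
    then have "0 < measure \<mu> (ball c (\<delta> / 4))" by (simp add: emeasure_eq_measure zero_less_measure_iff)
    also have "\<dots> = (LINT x|\<mu>. indicator (ball c (\<delta> / 4)) x)"
      using \<mu>(2) by (simp add: Int_absorb2 sets.sets_into_space)
    also have "\<dots> \<le> (LINT x|\<mu>. f x)"
    proof (intro integral_mono int)
      fix x
      have "f x = 1" if "x \<in> ball c (\<delta> / 4)"
        using that Basis_le_norm[of _ "x - c"]
        by (intro f1) (force simp: dist_norm norm_minus_commute)
      then show "indicator (ball c (\<delta> / 4)) x \<le> f x" using f(2) by (auto split: split_indicator)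
    qed (simp add: \<mu>(2) emeasure_eq_measure)
    finally show "0 < (LINT x|\<mu>. f x)" .
    have "x \<in> U" if "f x \<noteq> 0" for x
    proof -
      have "norm (x - c) \<le> (\<Sum>b\<in>Basis. \<bar>(x - c) \<bullet> b\<bar>)" by (rule norm_le_l1)
      also have "\<dots> < (\<Sum>b\<in>(Basis::'a set). \<delta>)"
        using f0[of x] that by (intro sum_strict_mono) (auto simp: not_le[symmetric])
      also have "\<dots> = \<epsilon>" by (simp add: \<delta>_def)
      finally show ?thesis using \<epsilon>(2) by (auto simp: dist_norm norm_minus_commute)
    qed
    then show "AE x in \<mu>. f x \<noteq> 0 \<longrightarrow> x \<in> A" using A(2) by (auto elim!: eventually_mono)
  qed
qed

section \<open>Dimension of a countable union\<close>

theorem corollary4: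
  fixes A :: "'i \<Rightarrow> 'a::euclidean_space set" and I :: "'i set"
  assumes "countable I"
    and "\<And>k. k \<in> I \<Longrightarrow> A k \<in> sets borel"
    and "\<And>n. n \<in> I \<Longrightarrow> countable (A n \<inter> closure (\<Union>k\<in>I - {n}. A k))"
  shows "fourier_dim (\<Union>k\<in>I. A k) = dim_Sup ((\<lambda>k. fourier_dim (A k)) ` I)"
proof (cases "I = {}")
  \<comment> \<open>No probability measure gives the empty set mass 1, so both sides are suprema of
    empty sets, that is 0.\<close>
  case True
  then show ?thesis
    by (simp add: fourier_dim_def borel_prob_on_def dim_Sup_def)
next
  case False
  let ?S = "SUP k\<in>I. fourier_dim (A k)"
  have bdd: "bdd_above ((\<lambda>k. fourier_dim (A k)) ` I)"
    by (intro bdd_aboveI[of _ "real DIM('a)"]) (auto intro: fourier_dim_range)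
  have S_upper: "fourier_dim (A k) \<le> ?S" if "k \<in> I" for k
    using bdd that by (intro cSUP_upper)
  have UN: "(\<Union>k\<in>I. A k) \<in> sets borel"
    using assms(1,2) by (intro sets.countable_UN') auto
  have S0: "0 \<le> ?S" using False S_upper fourier_dim_range(1) by (meson all_not_in_conv order_trans)
  have "fourier_dim (\<Union>k\<in>I. A k) \<le> ?S"
  proof (rule fourier_dim_le[OF _ S0])
    fix \<mu> assume "\<mu> \<in> borel_prob_on (\<Union>k\<in>I. A k)"
    then have \<mu>: "prob_space \<mu>" "sets \<mu> = sets borel" and U1: "measure \<mu> (\<Union>k\<in>I. A k) = 1"
      by (auto simp: borel_prob_on_def)
    interpret prob_space \<mu> by fact
    \<comment> \<open>Order 0 does not exclude atoms, so it is treated separately through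
      \<open>0 \<le> ?S\<close>.\<close>
    have "t \<le> ?S" if t: "fourier_decay \<mu> t" "0 < t" "t \<le> real DIM('a)" for t
    proof -
      have "\<exists>n\<in>I. emeasure \<mu> (A n) \<noteq> 0"
      proof (rule ccontr)
        assume "\<not> ?thesis"
        then have "(\<Union>k\<in>I. A k) \<in> null_sets \<mu>"
          using assms(1,2) by (intro null_sets_UN') (auto simp: null_sets_def \<mu>(2))
        then show False using U1 by (simp add: null_sets_def measure_def)
      qed
      then obtain n where n: "n \<in> I" "emeasure \<mu> (A n) \<noteq> 0" by blast
      define F where "F = closure (\<Union>k\<in>I - {n}. A k)"
      have F: "F \<in> sets borel" "open (- F)" by (auto simp: F_def)
      have "A n \<inter> F \<in> null_sets \<mu>"
        using fourier_decay_countable_null[OF \<mu> t(1,2) assms(3)[OF n(1)]] assms(2)[OF n(1)] F(1)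
        by (auto simp: null_sets_def \<mu>(2) emeasure_eq_measure F_def)
      \<comment> \<open>The overlap with \<open>F\<close> is countable, hence null, so the positive
        mass of \<open>A n\<close> must come from the open set \<open>- F\<close>.\<close>
      moreover have "A n \<subseteq> (A n \<inter> F) \<union> (- F)" by blast
      ultimately have "emeasure \<mu> (- F) \<noteq> 0"
        using n(2) F(1) assms(2)[OF n(1)] emeasure_mono[of "A n" "(A n \<inter> F) \<union> (- F)" \<mu>]
        by (auto simp: emeasure_Un_null_set \<mu>(2) Un_commute borel_comp)
      moreover have "AE x in \<mu>. x \<in> - F \<longrightarrow> x \<in> A n"
      proof -
        have "AE x in \<mu>. x \<in> (\<Union>k\<in>I. A k)"
          using U1 UN by (subst (asm) prob_eq_1) (auto simp: \<mu>(2))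
        \<comment> \<open>\<open>F\<close> contains every other \<open>A k\<close>, so off
          \<open>F\<close> the union reduces to \<open>A n\<close>.\<close>
        moreover have "x \<in> A n" if "x \<in> (\<Union>k\<in>I. A k)" "x \<notin> F" for x
          using that closure_subset[of "\<Union>k\<in>I - {n}. A k"] unfolding F_def by blast
        ultimately show ?thesis by (auto elim!: eventually_mono)
      qed
      ultimately obtain \<nu> where \<nu>: "\<nu> \<in> borel_prob_on (A n)" "fourier_decay \<nu> t"
        using fourier_decay_localize[OF \<mu> t(1) _ F(2) _ assms(2)[OF n(1)]] t(2) by auto
      have "t \<le> fourier_dim_measure \<nu>" using \<nu>(2) t by (intro fourier_dim_measure_ge) auto
      also have "\<dots> \<le> fourier_dim (A n)" by (rule fourier_dim_ge[OF \<nu>(1)])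
      also have "\<dots> \<le> ?S" by (rule S_upper[OF n(1)])
      finally show ?thesis .
    qed
    then have "t \<le> ?S" if "t \<in> {s \<in> {0..real DIM('a)}. fourier_decay \<mu> s}" for t
      using that S0 by (cases "t = 0") auto
    then show "fourier_dim_measure \<mu> \<le> ?S"
      unfolding fourier_dim_measure_def dim_Sup_def using S0 by (auto intro!: cSup_least)
  qed
  moreover have "?S \<le> fourier_dim (\<Union>k\<in>I. A k)"
    using False assms(2) UN by (intro cSUP_least fourier_dim_mono) auto
  ultimately show ?thesis using False by (simp add: dim_Sup_def)
qed

end
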